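(* Consider the charged-particle system $\ddot{x}=\tilde{B}(x)\dot{x}+F(x)$ and one step of the method EP with stepsize $h$, which maps $(x_n,v_n)$ to $(x_{n+1},v_{n+1})$ (system and method as defined in the context). Let $(x(t),v(t))$, $v=\dot{x}$, be the exact solution of the system and let $t_{n+1}=t_n+h$. Under the local assumptions $x(t_n)=x_n$ and $v(t_n)=v_n$, the method EP is of order two, i.e. $$x(t_{n+1})-x_{n+1}=\mathcal{O}(h^{3}),\qquad v(t_{n+1})-v_{n+1}=\mathcal{O}(h^{3}).$$
   Context: Charged-particle dynamics: $x(t)\in\mathbb{R}^3$ solves $\ddot{x}=\dot{x}\times B(x)+F(x)$, $x(t_0)=x^0$, $\dot{x}(t_0)=\dot{x}^0$, where $B(x)=\nabla_x\times A(x)$ for a vector potential $A(x)\in\mathbb{R}^3$ and $F(x)=-\nabla U(x)$ for a scalar potential $U(x)\in\mathbb{R}$. The potentials are assumed sufficiently smooth. Write $v=\dot{x}$ and $B=(B_1,B_2,B_3)^{\intercal}$, and let $$\tilde{B}(x)=\begin{pmatrix}0&B_3(x)&-B_2(x)\\-B_3(x)&0&B_1(x)\\ B_2(x)&-B_1(x)&0\end{pmatrix},$$ so that $\dot{x}\times B(x)=\tilde{B}(x)\dot{x}$. Method EP: for stepsize $h$, $(x_{n+1},v_{n+1})$ is defined implicitly from $(x_n,v_n)$ by $$x_{n+1}=x_n+hv_n+\tfrac{h^2}{2}\int_0^1F(x_n+\tau(x_{n+1}-x_n))\,d\tau+\tfrac{h^2}{2}\tilde{B}\big(\tfrac{x_{n+1}+x_n}{2}\big)\tfrac{v_{n+1}+v_n}{2},$$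 $$v_{n+1}=v_n+h\int_0^1F(x_n+\tau(x_{n+1}-x_n))\,d\tau+h\tilde{B}\big(\tfrac{x_{n+1}+x_n}{2}\big)\tfrac{v_{n+1}+v_n}{2}.$$ As usual for implicit one-step methods, $(x_{n+1},v_{n+1})$ is, for small $h$, the solution of these equations with $x_{n+1}=x_n+\mathcal{O}(h)$, $v_{n+1}=v_n+\mathcal{O}(h)$. The $\mathcal{O}$-statements are for $h\to0$. *)

theory Defs
  imports "HOL-Analysis.Analysis" "HOL-Library.Landau_Symbols"
begin

text \<open>Continuous differentiability of order \<open>k\<close> on the whole space: all iterated directional
  derivatives up to order \<open>k\<close> exist and are continuous.\<close>

primrec C_diff :: "nat \<Rightarrow> ('a::real_normed_vector \<Rightarrow> 'b::real_normed_vector) \<Rightarrow> bool" where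
  "C_diff 0 f \<longleftrightarrow> continuous_on UNIV f"
| "C_diff (Suc k) f \<longleftrightarrow>
     (\<forall>x. f differentiable (at x)) \<and>
     (\<forall>u. C_diff k (\<lambda>x. frechet_derivative f (at x) u))"

definition partial_deriv :: "3 \<Rightarrow> (real^3 \<Rightarrow> real) \<Rightarrow> real^3 \<Rightarrow> real" where
  "partial_deriv i f x = frechet_derivative f (at x) (axis i 1)"

definition grad :: "(real^3 \<Rightarrow> real) \<Rightarrow> real^3 \<Rightarrow> real^3" where
  "grad U x = (\<chi> i. partial_deriv i U x)"

definition curl :: "(real^3 \<Rightarrow> real^3) \<Rightarrow> real^3 \<Rightarrow> real^3" where
  "curl A x = vector
     [partial_deriv 2 (\<lambda>y. A y $ 3) x - partial_deriv 3 (\<lambda>y. A y $ 2) x,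
      partial_deriv 3 (\<lambda>y. A y $ 1) x - partial_deriv 1 (\<lambda>y. A y $ 3) x,
      partial_deriv 1 (\<lambda>y. A y $ 2) x - partial_deriv 2 (\<lambda>y. A y $ 1) x]"

definition Btilde :: "(real^3 \<Rightarrow> real^3) \<Rightarrow> real^3 \<Rightarrow> real^3^3" where
  "Btilde B x = vector
     [vector [0, B x $ 3, - B x $ 2],
      vector [- B x $ 3, 0, B x $ 1],
      vector [B x $ 2, - B x $ 1, 0]]"

lemma Btilde_mult: "Btilde B x *v w = cross3 w (B x)"
  by (simp add: Btilde_def cross3_def matrix_vector_mult_def vec_eq_iff forall_3 sum_3)

text \<open>The pair \<open>(x, v)\<close> with \<open>v = x'\<close> solves \<open>x'' = Btilde B x x' + F x\<close> on the open time
  interval \<open>T\<close>.\<close>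

definition charged_particle_solution ::
  "(real^3 \<Rightarrow> real^3) \<Rightarrow> (real^3 \<Rightarrow> real^3) \<Rightarrow> real set \<Rightarrow> (real \<Rightarrow> real^3) \<Rightarrow> (real \<Rightarrow> real^3) \<Rightarrow> bool" where
  "charged_particle_solution B F T x v \<longleftrightarrow>
     open T \<and> is_interval T \<and>
     (\<forall>t\<in>T. (x has_vector_derivative v t) (at t) \<and>
            (v has_vector_derivative (Btilde B (x t) *v v t + F (x t))) (at t))"

text \<open>The method is implicit, so a step is a relation: \<open>(x', v')\<close> satisfies the equations of one
  EP step of size \<open>h\<close> started at \<open>(x, v)\<close>.\<close>

definition EP_step ::
  "(real^3 \<Rightarrow> real^3) \<Rightarrow> (real^3 \<Rightarrow> real^3) \<Rightarrow> real \<Rightarrow>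
   real^3 \<Rightarrow> real^3 \<Rightarrow> real^3 \<Rightarrow> real^3 \<Rightarrow> bool" where
  "EP_step B F h x v x' v' \<longleftrightarrow>
     x' = x + h *\<^sub>R v
            + (h\<^sup>2 / 2) *\<^sub>R integral {0..1} (\<lambda>\<tau>. F (x + \<tau> *\<^sub>R (x' - x)))
            + (h\<^sup>2 / 2) *\<^sub>R (Btilde B ((1 / 2) *\<^sub>R (x' + x)) *v ((1 / 2) *\<^sub>R (v' + v))) \<and>
     v' = v + h *\<^sub>R integral {0..1} (\<lambda>\<tau>. F (x + \<tau> *\<^sub>R (x' - x)))
            + h *\<^sub>R (Btilde B ((1 / 2) *\<^sub>R (x' + x)) *v ((1 / 2) *\<^sub>R (v' + v)))"

text \<open>For small stepsizes \<open>h\<close> in \<open>H\<close>, the numerical result \<open>(X h, V h)\<close> is a solution of the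
  implicit equations started at \<open>(x, v)\<close>, on the branch with \<open>X h = x + O(h)\<close>,
  \<open>V h = v + O(h)\<close>. Other solutions of the implicit equations, not tending to \<open>(x, v)\<close>, are
  thereby excluded. The set \<open>H\<close> only fixes how \<open>h\<close> tends to 0: positive stepsizes are
  \<open>H = {0<..}\<close>, stepsizes of either sign are \<open>H = UNIV\<close>. Landau symbols in the library are for
  scalar functions, hence the norms.\<close>

definition EP_result ::
  "(real^3 \<Rightarrow> real^3) \<Rightarrow> (real^3 \<Rightarrow> real^3) \<Rightarrow> real set \<Rightarrow>
   real^3 \<Rightarrow> real^3 \<Rightarrow> (real \<Rightarrow> real^3) \<Rightarrow> (real \<Rightarrow> real^3) \<Rightarrow> bool" where
  "EP_result B F H x v X V \<longleftrightarrow>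
     (\<forall>\<^sub>F h in at 0 within H. EP_step B F h x v (X h) (V h)) \<and>
     (\<lambda>h. norm (X h - x)) \<in> O[at 0 within H](\<lambda>h. h) \<and>
     (\<lambda>h. norm (V h - v)) \<in> O[at 0 within H](\<lambda>h. h)"

end

theory Submission
  imports Defs
begin

text \<open>
  Both the exact flow and the numerical step have second-order Taylor polynomials in \<open>h\<close>, and the
  theorem holds because the two polynomials coincide. Let \<open>a\<^sub>0 = v\<^sub>n \<times> B x\<^sub>n + F x\<^sub>n\<close> be the
  acceleration at the starting point and \<open>a\<^sub>1\<close> its derivative along the flow,
  \<open>a\<^sub>1 = v\<^sub>n \<times> B' v\<^sub>n + a\<^sub>0 \<times> B x\<^sub>n + F' v\<^sub>n\<close>. In both cases the position is
  \<open>x\<^sub>n + h v\<^sub>n + (h\<^sup>2/2) a\<^sub>0 + O(h\<^sup>3)\<close> and the velocity is \<open>v\<^sub>n + h a\<^sub>0 + (h\<^sup>2/2) a\<^sub>1 + O(h\<^sup>3)\<close>.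

  For the exact solution, an expansion of position and velocity up to \<open>O(h\<^sup>k)\<close> gives one of the
  acceleration up to \<open>O(h\<^sup>k)\<close>, and integration gains a power of \<open>h\<close>. The method behaves in the
  same way: an expansion of \<open>X\<close> and \<open>V\<close> gives one of the averaged force, which enters \<open>V\<close> with a
  factor \<open>h\<close> and \<open>X\<close> with a factor \<open>h\<^sup>2/2\<close>. Starting from \<open>k = 1\<close> (differentiability of the
  solution, respectively the choice of the branch near the starting point), two rounds reach
  \<open>O(h\<^sup>3)\<close>. The averaging is what yields the order two: the midpoints, the averaged velocity and the
  mean value of \<open>F\<close> along the segment all have half the slope of the unaveraged quantities, so the
  averaged force is \<open>a\<^sub>0 + (h/2) a\<^sub>1 + O(h\<^sup>2)\<close>, and this is precisely the factor \<open>1/2\<close> that the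
  Taylor polynomial of the exact velocity has.

  Both arguments are therefore computations with first-order expansions in \<open>h\<close> (predicate
  \<open>jet\<close>). From the fields they need that \<open>B\<close> and \<open>F\<close> are approximated near \<open>x\<^sub>n\<close> by their
  linearizations up to a quadratic error (predicate \<open>quad_approx\<close>), and that \<open>F\<close> is continuous,
  so that its mean value along a segment is an honest integral. Both hold because \<open>B\<close> and \<open>F\<close>
  are linear in the first derivatives of the potentials, and those are of class \<open>C\<^sup>2\<close>.
\<close>

section \<open>Remainders of order \<open>h\<^sup>k\<close>\<close>

definition remainder :: "real set \<Rightarrow> nat \<Rightarrow> (real \<Rightarrow> 'a::real_normed_vector) \<Rightarrow> bool" where
  "remainder H k f \<longleftrightarrow> (\<lambda>h. norm (f h)) \<in> O[at 0 within H](\<lambda>h. h ^ k)"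

lemma remainderI:
  assumes "\<forall>\<^sub>F h in at 0 within H. norm (f h) \<le> C * \<bar>h\<bar> ^ k"
  shows "remainder H k f"
  unfolding remainder_def using assms
  by (intro bigoI[where c = C]) (simp add: power_abs)

lemma remainderE:
  assumes "remainder H k f"
  obtains C where "C > 0" "\<forall>\<^sub>F h in at 0 within H. norm (f h) \<le> C * \<bar>h\<bar> ^ k"
  using assms unfolding remainder_def
  by (elim landau_o.bigE) (simp add: power_abs)

lemma remainder_cong:
  assumes "\<forall>\<^sub>F h in at 0 within H. f h = g h" "remainder H k g"
  shows "remainder H k f"
proof -
  obtain C where "\<forall>\<^sub>F h in at 0 within H. norm (g h) \<le> C * \<bar>h\<bar> ^ k"
    using assms(2) by (blast elim: remainderE)
  with assms(1) have "\<forall>\<^sub>F h in at 0 within H. norm (f h) \<le> C * \<bar>h\<bar> ^ k"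
    by eventually_elim simp
  then show ?thesis by (rule remainderI)
qed

lemma remainder_within:
  assumes "remainder UNIV k f"
  shows "remainder H k f"
  using assms landau_o.big.filter_mono[OF at_le[of H UNIV 0]] unfolding remainder_def by blast

lemma remainder_add:
  assumes "remainder H k f" "remainder H k g"
  shows "remainder H k (\<lambda>h. f h + g h)"
proof -
  obtain C D where C: "\<forall>\<^sub>F h in at 0 within H. norm (f h) \<le> C * \<bar>h\<bar> ^ k"
    and D: "\<forall>\<^sub>F h in at 0 within H. norm (g h) \<le> D * \<bar>h\<bar> ^ k"
    using assms by (blast elim: remainderE)
  have "\<forall>\<^sub>F h in at 0 within H. norm (f h + g h) \<le> (C + D) * \<bar>h\<bar> ^ k"
    using C D by eventually_elim (simp add: distrib_right norm_triangle_le)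
  then show ?thesis by (rule remainderI)
qed

lemma remainder_linear:
  assumes "bounded_linear L" "remainder H k f"
  shows "remainder H k (\<lambda>h. L (f h))"
proof -
  obtain C where C: "\<forall>\<^sub>F h in at 0 within H. norm (f h) \<le> C * \<bar>h\<bar> ^ k"
    using assms(2) by (blast elim: remainderE)
  have "\<forall>\<^sub>F h in at 0 within H. norm (L (f h)) \<le> (onorm L * C) * \<bar>h\<bar> ^ k"
    using C
  proof eventually_elim
    case (elim h)
    have "norm (L (f h)) \<le> onorm L * norm (f h)"
      by (rule onorm[OF assms(1)])
    also have "\<dots> \<le> onorm L * (C * \<bar>h\<bar> ^ k)"
      by (intro mult_left_mono elim onorm_pos_le assms(1))
    finally show ?case by (simp add: mult.assoc)
  qed
  then show ?thesis by (rule remainderI)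
qed

lemma remainder_minus: "remainder H k f \<Longrightarrow> remainder H k (\<lambda>h. - f h)"
  by (simp add: remainder_def)

lemma remainder_diff:
  "remainder H k f \<Longrightarrow> remainder H k g \<Longrightarrow> remainder H k (\<lambda>h. f h - g h)"
  using remainder_add[OF _ remainder_minus, of H k f g] by simp

lemma remainder_scale:
  assumes "remainder H k f"
  shows "remainder H (m + k) (\<lambda>h. (h ^ m) *\<^sub>R f h)"
proof -
  obtain C where C: "\<forall>\<^sub>F h in at 0 within H. norm (f h) \<le> C * \<bar>h\<bar> ^ k"
    using assms by (blast elim: remainderE)
  have "\<forall>\<^sub>F h in at 0 within H. norm ((h ^ m) *\<^sub>R f h) \<le> C * \<bar>h\<bar> ^ (m + k)"
    using C
  proof eventually_elim
    case (elim h)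
    have "norm ((h ^ m) *\<^sub>R f h) = \<bar>h\<bar> ^ m * norm (f h)"
      by (simp add: power_abs)
    also have "\<dots> \<le> \<bar>h\<bar> ^ m * (C * \<bar>h\<bar> ^ k)"
      by (intro mult_left_mono elim) simp
    finally show ?case by (simp add: power_add algebra_simps)
  qed
  then show ?thesis by (rule remainderI)
qed

lemma remainder_const: "remainder H 0 (\<lambda>h. c)"
  by (rule remainderI[where C = "norm c"]) simp

lemma remainder_lower:
  assumes "remainder H k f" "j \<le> k"
  shows "remainder H j f"
proof -
  obtain C where "C > 0" and C: "\<forall>\<^sub>F h in at 0 within H. norm (f h) \<le> C * \<bar>h\<bar> ^ k"
    using assms by (blast elim: remainderE)
  have "\<forall>\<^sub>F h in at 0 within H. \<bar>h\<bar> < (1::real)"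
    by (auto simp: eventually_at intro: exI[of _ 1])
  with C have "\<forall>\<^sub>F h in at 0 within H. norm (f h) \<le> C * \<bar>h\<bar> ^ j"
  proof eventually_elim
    case (elim h)
    have "\<bar>h\<bar> ^ k \<le> \<bar>h\<bar> ^ j"
      using elim(2) assms(2) by (intro power_decreasing) auto
    with elim(1) \<open>C > 0\<close> show ?case
      by (meson mult_left_mono less_imp_le order_trans)
  qed
  then show ?thesis by (rule remainderI)
qed

lemma remainder_bilinear:
  assumes "bounded_bilinear b" "remainder H j f" "remainder H k g"
  shows "remainder H (j + k) (\<lambda>h. b (f h) (g h))"
proof -
  obtain K where "K > 0" and K: "\<And>x y. norm (b x y) \<le> norm x * norm y * K"
    using bounded_bilinear.pos_bounded[OF assms(1)] by blast
  obtain C D where "C > 0" and C: "\<forall>\<^sub>F h in at 0 within H. norm (f h) \<le> C * \<bar>h\<bar> ^ j"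
    and D: "\<forall>\<^sub>F h in at 0 within H. norm (g h) \<le> D * \<bar>h\<bar> ^ k"
    using assms(2,3) by (blast elim: remainderE)
  have "\<forall>\<^sub>F h in at 0 within H. norm (b (f h) (g h)) \<le> (C * D * K) * \<bar>h\<bar> ^ (j + k)"
    using C D
  proof eventually_elim
    case (elim h)
    have "norm (f h) * norm (g h) \<le> (C * \<bar>h\<bar> ^ j) * (D * \<bar>h\<bar> ^ k)"
      using elim \<open>C > 0\<close> by (intro mult_mono) auto
    then have "norm (f h) * norm (g h) * K \<le> (C * \<bar>h\<bar> ^ j) * (D * \<bar>h\<bar> ^ k) * K"
      using \<open>K > 0\<close> by (intro mult_right_mono) auto
    with K[of "f h" "g h"] show ?case by (simp add: power_add algebra_simps)
  qed
  then show ?thesis by (rule remainderI)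
qed

text \<open>The filter \<open>at 0\<close> ignores the value at \<open>0\<close>, but the mean value estimate runs over a segment
  that contains \<open>0\<close>; hence the hypothesis on \<open>e' 0\<close>.\<close>

lemma remainder_antiderivative:
  assumes deriv: "\<forall>\<^sub>F h in nhds 0. (e has_vector_derivative e' h) (at h)"
    and "e 0 = 0" "e' 0 = 0" "remainder UNIV k e'"
  shows "remainder UNIV (Suc k) e"
proof -
  obtain C where "C > 0" and C: "\<forall>\<^sub>F h in at 0. norm (e' h) \<le> C * \<bar>h\<bar> ^ k"
    using assms(4) by (blast elim: remainderE)
  have "\<forall>\<^sub>F h in nhds 0. norm (e' h) \<le> C * \<bar>h\<bar> ^ k"
    using C \<open>C > 0\<close> by (auto simp: eventually_at_filter \<open>e' 0 = 0\<close> elim: eventually_mono)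
  with deriv have "\<forall>\<^sub>F h in nhds 0. (e has_vector_derivative e' h) (at h) \<and> norm (e' h) \<le> C * \<bar>h\<bar> ^ k"
    by eventually_elim simp
  then obtain d where "d > 0" and d: "\<And>s. \<bar>s\<bar> < d \<Longrightarrow>
      (e has_vector_derivative e' s) (at s) \<and> norm (e' s) \<le> C * \<bar>s\<bar> ^ k"
    by (auto simp: eventually_nhds_metric)
  have bound: "norm (e h) \<le> C * \<bar>h\<bar> ^ Suc k" if "\<bar>h\<bar> < d" for h
  proof -
    have "norm (e h - e 0) \<le> (C * \<bar>h\<bar> ^ k) * norm (h - 0)"
    proof (rule differentiable_bound[where S = "closed_segment 0 h"])
      fix s assume "s \<in> closed_segment 0 h"
      then have s: "\<bar>s\<bar> \<le> \<bar>h\<bar>"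
        by (auto simp: closed_segment_eq_real_ivl split: if_splits)
      with that have ds: "\<bar>s\<bar> < d" by simp
      show "(e has_derivative (\<lambda>u. u *\<^sub>R e' s)) (at s within closed_segment 0 h)"
        using d[OF ds] by (simp add: has_vector_derivative_def has_derivative_at_withinI)
      have "norm (e' s) \<le> C * \<bar>h\<bar> ^ k"
        using d[OF ds] s \<open>C > 0\<close>
        by (meson abs_ge_zero less_imp_le mult_left_mono order_trans power_mono)
      then show "onorm (\<lambda>u. u *\<^sub>R e' s) \<le> C * \<bar>h\<bar> ^ k"
        by (intro onorm_le) (simp add: mult.commute mult_left_mono)
    qed auto
    then show ?thesis by (simp add: \<open>e 0 = 0\<close> mult_ac)
  qed
  have "\<forall>\<^sub>F h in at 0. norm (e h) \<le> C * \<bar>h\<bar> ^ Suc k"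
    using \<open>d > 0\<close> bound by (auto simp: eventually_at)
  then show ?thesis by (rule remainderI)
qed

section \<open>Linearization with a quadratic error\<close>

definition quad_approx ::
  "('a::real_normed_vector \<Rightarrow> 'b::real_normed_vector) \<Rightarrow> ('a \<Rightarrow> 'b) \<Rightarrow> 'a \<Rightarrow> bool" where
  "quad_approx f L y\<^sub>0 \<longleftrightarrow> bounded_linear L \<and>
     (\<exists>K. \<forall>\<^sub>F y in nhds y\<^sub>0. norm (f y - f y\<^sub>0 - L (y - y\<^sub>0)) \<le> K * (norm (y - y\<^sub>0))\<^sup>2)"

lemma quad_approx_linear:
  assumes "bounded_linear c" "quad_approx f L y\<^sub>0"
  shows "quad_approx (\<lambda>y. c (f y)) (\<lambda>d. c (L d)) y\<^sub>0"
proof -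
  obtain K where L: "bounded_linear L"
    and K: "\<forall>\<^sub>F y in nhds y\<^sub>0. norm (f y - f y\<^sub>0 - L (y - y\<^sub>0)) \<le> K * (norm (y - y\<^sub>0))\<^sup>2"
    using assms(2) unfolding quad_approx_def by blast
  have "\<forall>\<^sub>F y in nhds y\<^sub>0. norm (c (f y) - c (f y\<^sub>0) - c (L (y - y\<^sub>0)))
      \<le> (onorm c * K) * (norm (y - y\<^sub>0))\<^sup>2"
    using K
  proof eventually_elim
    case (elim y)
    have "c (f y) - c (f y\<^sub>0) - c (L (y - y\<^sub>0)) = c (f y - f y\<^sub>0 - L (y - y\<^sub>0))"
      using assms(1) by (simp add: bounded_linear.linear linear_diff)
    also have "norm \<dots> \<le> onorm c * norm (f y - f y\<^sub>0 - L (y - y\<^sub>0))"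
      by (rule onorm[OF assms(1)])
    also have "\<dots> \<le> onorm c * (K * (norm (y - y\<^sub>0))\<^sup>2)"
      by (intro mult_left_mono elim onorm_pos_le assms(1))
    finally show ?case by (simp add: mult.assoc)
  qed
  moreover have "bounded_linear (\<lambda>d. c (L d))"
    by (rule bounded_linear_compose[OF assms(1) L])
  ultimately show ?thesis unfolding quad_approx_def by blast
qed

lemma quad_approx_sum:
  assumes "finite I" "\<And>i. i \<in> I \<Longrightarrow> quad_approx (f i) (L i) y\<^sub>0"
  shows "quad_approx (\<lambda>y. \<Sum>i\<in>I. f i y) (\<lambda>d. \<Sum>i\<in>I. L i d) y\<^sub>0"
proof -
  have "\<forall>i\<in>I. \<exists>K. \<forall>\<^sub>F y in nhds y\<^sub>0.
      norm (f i y - f i y\<^sub>0 - L i (y - y\<^sub>0)) \<le> K * (norm (y - y\<^sub>0))\<^sup>2"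
    using assms(2) by (simp add: quad_approx_def)
  from bchoice[OF this] obtain K where K: "\<And>i. i \<in> I \<Longrightarrow>
      \<forall>\<^sub>F y in nhds y\<^sub>0. norm (f i y - f i y\<^sub>0 - L i (y - y\<^sub>0)) \<le> K i * (norm (y - y\<^sub>0))\<^sup>2"
    by blast
  have "\<forall>\<^sub>F y in nhds y\<^sub>0. \<forall>i\<in>I. norm (f i y - f i y\<^sub>0 - L i (y - y\<^sub>0)) \<le> K i * (norm (y - y\<^sub>0))\<^sup>2"
    using K assms(1) by (simp add: eventually_ball_finite)
  then have "\<forall>\<^sub>F y in nhds y\<^sub>0. norm ((\<Sum>i\<in>I. f i y) - (\<Sum>i\<in>I. f i y\<^sub>0) - (\<Sum>i\<in>I. L i (y - y\<^sub>0)))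
      \<le> (\<Sum>i\<in>I. K i) * (norm (y - y\<^sub>0))\<^sup>2"
    by eventually_elim (simp add: sum_distrib_right sum_norm_le flip: sum_subtractf)
  moreover have "bounded_linear (\<lambda>d. \<Sum>i\<in>I. L i d)"
    using assms(2) by (intro bounded_linear_sum) (simp add: quad_approx_def)
  ultimately show ?thesis unfolding quad_approx_def by blast
qed

lemma differentiable_linear_bound:
  assumes "f differentiable (at x)"
  obtains K where "\<forall>\<^sub>F y in nhds x. norm (f y - f x) \<le> K * norm (y - x)"
proof -
  obtain f' where f': "bounded_linear f'"
    and "\<forall>e>0. \<exists>d>0. \<forall>y. norm (y - x) < d \<longrightarrow> norm (f y - f x - f' (y - x)) \<le> e * norm (y - x)"
    using assms unfolding differentiable_def has_derivative_at_alt by blast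
  then obtain d where "d > 0"
    and d: "\<And>y. norm (y - x) < d \<Longrightarrow> norm (f y - f x - f' (y - x)) \<le> 1 * norm (y - x)"
    using zero_less_one by blast
  have "norm (f y - f x) \<le> (onorm f' + 1) * norm (y - x)" if "norm (y - x) < d" for y
    using d[OF that] onorm[OF f', of "y - x"] norm_triangle_sub[of "f y - f x" "f' (y - x)"]
    by (simp add: distrib_right)
  then have "\<forall>\<^sub>F y in nhds x. norm (f y - f x) \<le> (onorm f' + 1) * norm (y - x)"
    using \<open>d > 0\<close> by (auto simp: eventually_nhds_metric dist_norm)
  then show thesis by (rule that)
qed

text \<open>Let \<open>f'\<close> be the derivative at \<open>x\<close>. The derivative of \<open>f - f'\<close> at \<open>y\<close> is bounded by
  a multiple of \<open>norm (y - x)\<close>, because each of the finitely many partial derivatives is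
  differentiable at \<open>x\<close>. The mean value inequality on
  the ball through \<open>y\<close> then produces the second factor \<open>norm (y - x)\<close>.\<close>

lemma C_diff_2_quad_approx:
  fixes f :: "'a::euclidean_space \<Rightarrow> 'b::real_normed_vector"
  assumes "C_diff 2 f"
  shows "quad_approx f (frechet_derivative f (at x)) x"
proof -
  let ?D = "\<lambda>y. frechet_derivative f (at y)"
  have "C_diff (Suc (Suc 0)) f" using assms by (simp only: numeral_2_eq_2)
  then have f_diff: "\<And>y. f differentiable (at y)"
    and D_diff: "\<And>u y. (\<lambda>y. ?D y u) differentiable (at y)"
    by auto
  have D: "(f has_derivative ?D y) (at y)" for y
    using f_diff frechet_derivative_works by blast
  have lin: "bounded_linear (?D y)" for y
    using D has_derivative_bounded_linear by blast
  have "\<forall>i. \<exists>K. \<forall>\<^sub>F y in nhds x. norm (?D y i - ?D x i) \<le> K * norm (y - x)"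
    using differentiable_linear_bound[OF D_diff] by blast
  from choice[OF this]
  obtain K where K: "\<And>i. \<forall>\<^sub>F y in nhds x. norm (?D y i - ?D x i) \<le> K i * norm (y - x)"
    by blast
  have "\<forall>\<^sub>F y in nhds x. \<forall>i\<in>Basis. norm (?D y i - ?D x i) \<le> K i * norm (y - x)"
    using K by (simp add: eventually_ball_finite)
  then obtain d where "d > 0" and d: "\<And>y i. dist y x < d \<Longrightarrow> i \<in> Basis \<Longrightarrow>
      norm (?D y i - ?D x i) \<le> K i * norm (y - x)"
    by (auto simp: eventually_nhds_metric)
  define C where "C = (\<Sum>i\<in>Basis. \<bar>K i\<bar>)"
  have op: "norm (?D y u - ?D x u) \<le> (C * norm (y - x)) * norm u" if y: "dist y x < d" for y u
  proof -
    have E: "linear (\<lambda>u. ?D y u - ?D x u)"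
      by (intro linear_compose_sub bounded_linear.linear lin)
    have "?D y u - ?D x u = (\<lambda>u. ?D y u - ?D x u) (\<Sum>i\<in>Basis. (u \<bullet> i) *\<^sub>R i)"
      by (simp add: euclidean_representation)
    also have "\<dots> = (\<Sum>i\<in>Basis. (u \<bullet> i) *\<^sub>R (?D y i - ?D x i))"
      by (subst linear_sum[OF E]) (simp add: linear_scale[OF E])
    also have "norm \<dots> \<le> (\<Sum>i\<in>Basis. \<bar>K i\<bar> * norm (y - x) * norm u)"
    proof (rule sum_norm_le)
      fix i :: 'a assume i: "i \<in> Basis"
      have "norm (?D y i - ?D x i) \<le> \<bar>K i\<bar> * norm (y - x)"
        using d[OF y i] by (meson abs_ge_self mult_right_mono norm_ge_zero order_trans)
      then show "norm ((u \<bullet> i) *\<^sub>R (?D y i - ?D x i)) \<le> \<bar>K i\<bar> * norm (y - x) * norm u"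
        using mult_mono[OF Basis_le_norm[OF i, of u]] by (simp add: mult.commute[of _ "norm u"])
    qed
    finally show ?thesis by (simp add: C_def sum_distrib_right)
  qed
  have "norm (f y - f x - ?D x (y - x)) \<le> C * (norm (y - x))\<^sup>2" if y: "dist y x < d" for y
  proof -
    have "norm ((f y - ?D x y) - (f x - ?D x x)) \<le> (C * norm (y - x)) * norm (y - x)"
    proof (rule differentiable_bound[where S = "cball x (norm (y - x))"])
      fix z assume "z \<in> cball x (norm (y - x))"
      then have zy: "norm (z - x) \<le> norm (y - x)"
        by (simp add: dist_norm norm_minus_commute)
      then have z: "dist z x < d" using y by (simp add: dist_norm)
      show "((\<lambda>y. f y - ?D x y) has_derivative (\<lambda>u. ?D z u - ?D x u))
          (at z within cball x (norm (y - x)))"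
        by (intro has_derivative_diff has_derivative_at_withinI[OF D]
            bounded_linear_imp_has_derivative lin)
      have "C \<ge> 0" by (simp add: C_def sum_nonneg)
      then have "(C * norm (z - x)) * norm u \<le> (C * norm (y - x)) * norm u" for u :: 'a
        using zy by (intro mult_right_mono mult_left_mono) auto
      then show "onorm (\<lambda>u. ?D z u - ?D x u) \<le> C * norm (y - x)"
        using op[OF z] by (intro onorm_le) (rule order_trans)
    qed (auto simp: dist_norm norm_minus_commute)
    moreover have "(f y - ?D x y) - (f x - ?D x x) = f y - f x - ?D x (y - x)"
      using linear_diff[OF bounded_linear.linear[OF lin]] by simp
    ultimately show ?thesis by (simp add: power2_eq_square mult.assoc)
  qed
  then have "\<forall>\<^sub>F y in nhds x. norm (f y - f x - ?D x (y - x)) \<le> C * (norm (y - x))\<^sup>2"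
    using \<open>d > 0\<close> by (auto simp: eventually_nhds_metric)
  with lin show ?thesis unfolding quad_approx_def by blast
qed

text \<open>Averaging over the segment from \<open>y\<^sub>0\<close> to \<open>y\<close> halves the slope, as the integral of \<open>\<tau>\<close> over
  the unit interval is \<open>1/2\<close>.\<close>

lemma quad_approx_segment_mean:
  fixes f :: "'a::real_normed_vector \<Rightarrow> 'b::euclidean_space"
  assumes cont: "continuous_on UNIV f" and "quad_approx f L y\<^sub>0"
  shows "quad_approx (\<lambda>y. integral {0..1} (\<lambda>\<tau>. f (y\<^sub>0 + \<tau> *\<^sub>R (y - y\<^sub>0)))) (\<lambda>d. (1 / 2) *\<^sub>R L d) y\<^sub>0"
proof -
  obtain K where L: "bounded_linear L"
    and "\<forall>\<^sub>F y in nhds y\<^sub>0. norm (f y - f y\<^sub>0 - L (y - y\<^sub>0)) \<le> K * (norm (y - y\<^sub>0))\<^sup>2"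
    using assms(2) unfolding quad_approx_def by blast
  then obtain d where "d > 0"
    and d: "\<And>y. dist y y\<^sub>0 < d \<Longrightarrow> norm (f y - f y\<^sub>0 - L (y - y\<^sub>0)) \<le> K * (norm (y - y\<^sub>0))\<^sup>2"
    by (auto simp: eventually_nhds_metric)
  have "norm (integral {0..1} (\<lambda>\<tau>. f (y\<^sub>0 + \<tau> *\<^sub>R (y - y\<^sub>0))) - f y\<^sub>0 - (1 / 2) *\<^sub>R L (y - y\<^sub>0))
      \<le> \<bar>K\<bar> * (norm (y - y\<^sub>0))\<^sup>2" if y: "dist y y\<^sub>0 < d" for y
  proof -
    let ?g = "\<lambda>\<tau>. f (y\<^sub>0 + \<tau> *\<^sub>R (y - y\<^sub>0))"
    let ?r = "\<lambda>\<tau>. ?g \<tau> - (f y\<^sub>0 + \<tau> *\<^sub>R L (y - y\<^sub>0))"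
    have g: "continuous_on {0..1} ?g"
      by (intro continuous_on_compose2[OF cont] continuous_intros) auto
    have lin: "((\<lambda>\<tau>. f y\<^sub>0 + \<tau> *\<^sub>R L (y - y\<^sub>0)) has_integral f y\<^sub>0 + (1 / 2) *\<^sub>R L (y - y\<^sub>0)) {0..1}"
    proof -
      have "((\<lambda>\<tau>::real. \<tau>) has_integral 1 / 2) {0..1}"
        using ident_has_integral[of 0 1] by simp
      moreover have "((\<lambda>\<tau>::real. f y\<^sub>0) has_integral f y\<^sub>0) {0..1}"
        using has_integral_const_real[of "f y\<^sub>0" 0 1] by simp
      ultimately show ?thesis
        by (intro has_integral_add has_integral_scaleR_left)
    qed
    have "integral {0..1} ?g - f y\<^sub>0 - (1 / 2) *\<^sub>R L (y - y\<^sub>0) = integral {0..1} ?r"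
      using integral_diff[OF integrable_continuous_interval[OF g] has_integral_integrable[OF lin]]
        integral_unique[OF lin] by simp
    also have "norm \<dots> \<le> \<bar>K\<bar> * (norm (y - y\<^sub>0))\<^sup>2 * (1 - 0)"
    proof (rule integral_bound)
      show "continuous_on {0..1} ?r"
        by (intro continuous_intros g)
      fix \<tau> :: real assume \<tau>: "\<tau> \<in> {0..1}"
      let ?z = "y\<^sub>0 + \<tau> *\<^sub>R (y - y\<^sub>0)"
      have le: "norm (?z - y\<^sub>0) \<le> norm (y - y\<^sub>0)"
        using \<tau> by (simp add: mult_left_le_one_le)
      then have "dist ?z y\<^sub>0 < d" using y by (simp add: dist_norm)
      then have "norm (f ?z - f y\<^sub>0 - L (?z - y\<^sub>0)) \<le> K * (norm (?z - y\<^sub>0))\<^sup>2" by (rule d)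
      also have "\<dots> \<le> \<bar>K\<bar> * (norm (y - y\<^sub>0))\<^sup>2"
        using le by (intro mult_mono power_mono) auto
      finally show "norm (?r \<tau>) \<le> \<bar>K\<bar> * (norm (y - y\<^sub>0))\<^sup>2"
        using linear_scale[OF bounded_linear.linear[OF L]] by (simp add: diff_diff_eq)
    qed simp
    finally show ?thesis by simp
  qed
  then have "\<forall>\<^sub>F y in nhds y\<^sub>0. norm (integral {0..1} (\<lambda>\<tau>. f (y\<^sub>0 + \<tau> *\<^sub>R (y - y\<^sub>0)))
      - integral {0..1} (\<lambda>\<tau>. f (y\<^sub>0 + \<tau> *\<^sub>R (y\<^sub>0 - y\<^sub>0))) - (1 / 2) *\<^sub>R L (y - y\<^sub>0))
      \<le> \<bar>K\<bar> * (norm (y - y\<^sub>0))\<^sup>2"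
    using \<open>d > 0\<close> by (auto simp: eventually_nhds_metric)
  moreover have "bounded_linear (\<lambda>d. (1 / 2) *\<^sub>R L d)"
    by (rule bounded_linear_const_scaleR[OF L])
  ultimately show ?thesis unfolding quad_approx_def by blast
qed

section \<open>First-order expansions in the stepsize\<close>

text \<open>The exponent \<open>k\<close> ranges over \<open>1\<close> and \<open>2\<close>. Each closure property below holds for both, so the
  same lemmas serve both rounds of the bootstrap. For \<open>k = 1\<close> the slope \<open>q\<close> carries no
  information, but keeping it lets the first round be stated with the slopes of the second.\<close>

definition jet ::
  "real set \<Rightarrow> nat \<Rightarrow> (real \<Rightarrow> 'a::real_normed_vector) \<Rightarrow> 'a \<Rightarrow> 'a \<Rightarrow> bool" where
  "jet H k f p q \<longleftrightarrow> remainder H k (\<lambda>h. f h - p - h *\<^sub>R q)"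

lemma remainder_linear_term: "remainder H 1 (\<lambda>h. h *\<^sub>R c)"
  using remainder_scale[OF remainder_const, of H 1 c] by simp

lemma remainder_quadratic_term: "remainder H 2 (\<lambda>h. h\<^sup>2 *\<^sub>R c)"
  using remainder_scale[OF remainder_const, of H 2 c] by (simp add: numeral_2_eq_2)

lemma jet_remainder_1:
  assumes "jet H k f p q" "1 \<le> k"
  shows "remainder H 1 (\<lambda>h. f h - p)"
  using remainder_add[OF remainder_lower[OF assms[unfolded jet_def]] remainder_linear_term[of H q]]
  by simp

lemma remainder_1_jet:
  assumes "remainder H 1 (\<lambda>h. f h - p)"
  shows "jet H 1 f p q"
  unfolding jet_def by (rule remainder_diff[OF assms remainder_linear_term])

lemma jet_bounded:
  assumes "jet H k f p q" "1 \<le> k"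
  shows "remainder H 0 f"
  using remainder_add[OF remainder_lower[OF jet_remainder_1[OF assms]] remainder_const[of H p]]
  by simp

lemma jet_const: "jet H k (\<lambda>h. c) c 0"
  unfolding jet_def by (rule remainderI[where C = 0]) simp

lemma jet_add:
  assumes "jet H k f p q" "jet H k g p' q'"
  shows "jet H k (\<lambda>h. f h + g h) (p + p') (q + q')"
  using remainder_add[OF assms[unfolded jet_def]] by (simp add: jet_def algebra_simps)

lemma jet_scaleR:
  assumes "jet H k f p q"
  shows "jet H k (\<lambda>h. c *\<^sub>R f h) (c *\<^sub>R p) (c *\<^sub>R q)"
  using remainder_linear[OF bounded_linear_scaleR_right[of c] assms[unfolded jet_def]]
  by (simp add: jet_def algebra_simps)

text \<open>The constraint \<open>k \<le> 2\<close> enters here through the product of the two linear terms, and in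
  \<open>jet_compose\<close> through the quadratic error of the linearization.\<close>

lemma jet_bilinear:
  assumes b: "bounded_bilinear b" and f: "jet H k f p q" and g: "jet H k g p' q'"
    and k: "1 \<le> k" "k \<le> 2"
  shows "jet H k (\<lambda>h. b (f h) (g h)) (b p p') (b p q' + b q p')"
proof -
  interpret bounded_bilinear b by (rule b)
  have lin: "remainder H 0 (\<lambda>h. p' + h *\<^sub>R q')"
    by (intro remainder_add remainder_const remainder_lower[OF remainder_linear_term]) simp
  have "remainder H k (\<lambda>h. b (f h) (g h - p' - h *\<^sub>R q'))"
    using remainder_bilinear[OF b jet_bounded[OF f k(1)] g[unfolded jet_def]] by simp
  moreover have "remainder H k (\<lambda>h. b (f h - p - h *\<^sub>R q) (p' + h *\<^sub>R q'))"
    using remainder_bilinear[OF b f[unfolded jet_def] lin] by simp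
  moreover have "remainder H k (\<lambda>h. h\<^sup>2 *\<^sub>R b q q')"
    by (rule remainder_lower[OF remainder_quadratic_term k(2)])
  ultimately have "remainder H k (\<lambda>h. b (f h) (g h - p' - h *\<^sub>R q')
      + b (f h - p - h *\<^sub>R q) (p' + h *\<^sub>R q') + h\<^sup>2 *\<^sub>R b q q')"
    by (intro remainder_add)
  moreover have "b (f h) (g h - p' - h *\<^sub>R q') + b (f h - p - h *\<^sub>R q) (p' + h *\<^sub>R q') + h\<^sup>2 *\<^sub>R b q q'
      = b (f h) (g h) - b p p' - h *\<^sub>R (b p q' + b q p')" for h
    unfolding add_left add_right diff_left diff_right scaleR_left scaleR_right
    by (simp add: scaleR_add_right scaleR_diff_right power2_eq_square)
  ultimately show ?thesis by (simp add: jet_def)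
qed

lemma remainder_tendsto:
  assumes "remainder H 1 (\<lambda>h. Y h - y)"
  shows "(Y \<longlongrightarrow> y) (at 0 within H)"
proof -
  obtain C where C: "\<forall>\<^sub>F h in at 0 within H. norm (Y h - y) \<le> C * \<bar>h\<bar> ^ 1"
    using assms by (blast elim: remainderE)
  have "((\<lambda>h. C * \<bar>h\<bar> ^ 1) \<longlongrightarrow> 0) (at 0 within H)"
    by (auto intro!: tendsto_eq_intros)
  then have "((\<lambda>h. Y h - y) \<longlongrightarrow> 0) (at 0 within H)"
    by (rule Lim_null_comparison[OF C])
  then show ?thesis by (rule LIM_zero_cancel)
qed

lemma jet_compose:
  assumes f: "quad_approx f L y" and Y: "jet H k Y y p" and k: "1 \<le> k" "k \<le> 2"
  shows "jet H k (\<lambda>h. f (Y h)) (f y) (L p)"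
proof -
  obtain K where L: "bounded_linear L"
    and K: "\<forall>\<^sub>F z in nhds y. norm (f z - f y - L (z - y)) \<le> K * (norm (z - y))\<^sup>2"
    using f unfolding quad_approx_def by blast
  have Y1: "remainder H 1 (\<lambda>h. Y h - y)"
    by (rule jet_remainder_1[OF Y k(1)])
  obtain C where "C > 0" and C: "\<forall>\<^sub>F h in at 0 within H. norm (Y h - y) \<le> C * \<bar>h\<bar> ^ 1"
    using Y1 by (rule remainderE)
  have "\<forall>\<^sub>F h in at 0 within H. norm (f (Y h) - f y - L (Y h - y)) \<le> K * (norm (Y h - y))\<^sup>2"
    using filterlim_iff[THEN iffD1, OF remainder_tendsto[OF Y1]] K by blast
  with C have "\<forall>\<^sub>F h in at 0 within H. norm (f (Y h) - f y - L (Y h - y)) \<le> (\<bar>K\<bar> * C\<^sup>2) * \<bar>h\<bar> ^ 2"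
  proof eventually_elim
    case (elim h)
    have "(norm (Y h - y))\<^sup>2 \<le> (C * \<bar>h\<bar> ^ 1)\<^sup>2"
      using elim(1) by (rule power_mono) simp
    then have "\<bar>K\<bar> * (norm (Y h - y))\<^sup>2 \<le> \<bar>K\<bar> * (C * \<bar>h\<bar> ^ 1)\<^sup>2"
      by (rule mult_left_mono) simp
    moreover have "K * (norm (Y h - y))\<^sup>2 \<le> \<bar>K\<bar> * (norm (Y h - y))\<^sup>2"
      by (rule mult_right_mono) auto
    ultimately show ?case using elim(2) by (simp add: power_mult_distrib mult.assoc)
  qed
  then have "remainder H k (\<lambda>h. f (Y h) - f y - L (Y h - y))"
    by (intro remainder_lower[OF remainderI k(2)])
  moreover have "remainder H k (\<lambda>h. L (Y h - y - h *\<^sub>R p))"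
    by (rule remainder_linear[OF L Y[unfolded jet_def]])
  ultimately have "remainder H k (\<lambda>h. (f (Y h) - f y - L (Y h - y)) + L (Y h - y - h *\<^sub>R p))"
    by (rule remainder_add)
  then show ?thesis
    using bounded_linear.linear[OF L] by (simp add: jet_def linear_diff linear_scale)
qed

lemma has_vector_derivative_jet:
  assumes "(f has_vector_derivative D) (at t)"
  shows "jet UNIV 1 (\<lambda>h. f (t + h)) (f t) q"
proof (rule remainder_1_jet)
  have "f differentiable (at t)"
    using assms by (auto simp: has_vector_derivative_def differentiable_def)
  then obtain K where "\<forall>\<^sub>F s in nhds t. norm (f s - f t) \<le> K * norm (s - t)"
    by (rule differentiable_linear_bound)
  moreover have "filterlim (\<lambda>h. t + h) (nhds t) (at 0)"
    by (auto intro!: tendsto_eq_intros)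
  ultimately have "\<forall>\<^sub>F h in at 0. norm (f (t + h) - f t) \<le> K * norm ((t + h) - t)"
    by (rule eventually_compose_filterlim)
  then show "remainder UNIV 1 (\<lambda>h. f (t + h) - f t)"
    by (intro remainderI[where C = K]) simp
qed

text \<open>Integrating an expansion of the derivative gains one power of \<open>h\<close>.\<close>

lemma jet_antiderivative:
  assumes "open T" "t \<in> T" and deriv: "\<And>s. s \<in> T \<Longrightarrow> (f has_vector_derivative g s) (at s)"
    and g: "jet UNIV k (\<lambda>h. g (t + h)) (g t) q"
  shows "remainder UNIV (Suc k) (\<lambda>h. f (t + h) - f t - h *\<^sub>R g t - (h\<^sup>2 / 2) *\<^sub>R q)"
proof (rule remainder_antiderivative)
  have "filterlim (\<lambda>h. t + h) (nhds t) (nhds 0)"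
    using tendsto_add[OF tendsto_const filterlim_ident, of t 0] by simp
  with eventually_nhds_in_open[OF assms(1,2)] have "\<forall>\<^sub>F h in nhds 0. t + h \<in> T"
    by (rule eventually_compose_filterlim)
  then show "\<forall>\<^sub>F h in nhds 0. ((\<lambda>h. f (t + h) - f t - h *\<^sub>R g t - (h\<^sup>2 / 2) *\<^sub>R q)
      has_vector_derivative g (t + h) - g t - h *\<^sub>R q) (at h)"
  proof eventually_elim
    case (elim h)
    have "((\<lambda>h. t + h) has_vector_derivative 1) (at h)"
      by (auto intro!: derivative_eq_intros)
    then have "((\<lambda>h. f (t + h)) has_vector_derivative g (t + h)) (at h)"
      using vector_diff_chain_at[of "\<lambda>h. t + h" 1 h f "g (t + h)"] deriv[OF elim]
      by (simp add: o_def)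
    then show ?case
      by (auto intro!: derivative_eq_intros simp: has_real_derivative_iff_has_vector_derivative[symmetric])
  qed
  show "remainder UNIV k (\<lambda>h. g (t + h) - g t - h *\<^sub>R q)"
    using g by (simp add: jet_def)
qed auto

text \<open>Forgetting the quadratic term turns the result of one integration into the input of the
  next round.\<close>

lemma remainder_quadratic_jet:
  assumes "remainder H 2 (\<lambda>h. f h - p - h *\<^sub>R q - (h\<^sup>2 / 2) *\<^sub>R c)"
  shows "jet H 2 f p q"
  using remainder_add[OF assms remainder_quadratic_term[of H "(1 / 2) *\<^sub>R c"]] by (simp add: jet_def)

section \<open>Regularity of the fields\<close>

lemma C_diff_3:
  assumes "C_diff 3 f"
  shows "f differentiable (at y)" "C_diff 2 (\<lambda>y. frechet_derivative f (at y) u)"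
proof -
  have "C_diff (Suc 2) f" using assms by simp
  then show "f differentiable (at y)" "C_diff 2 (\<lambda>y. frechet_derivative f (at y) u)"
    by (simp_all only: C_diff.simps)
qed

lemma bounded_bilinear_cross3: "bounded_bilinear cross3"
  using bilinear_cross bilinear_conv_bounded_bilinear by blast

text \<open>The curl is \<open>\<Sum>\<^sub>i e\<^sub>i \<times> \<partial>\<^sub>i A\<close>, which displays it as linear in the derivatives of \<open>A\<close>.\<close>

lemma curl_eq_sum_cross3:
  assumes "A differentiable (at y)"
  shows "curl A y = (\<Sum>i\<in>UNIV. cross3 (axis i 1) (frechet_derivative A (at y) (axis i 1)))"
proof -
  have "((\<lambda>y. A y $ j) has_derivative (\<lambda>u. frechet_derivative A (at y) u $ j)) (at y)" for j
    using assms by (intro bounded_linear.has_derivative[OF bounded_linear_vec_nth])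
      (simp add: frechet_derivative_works)
  then have "partial_deriv i (\<lambda>y. A y $ j) y = frechet_derivative A (at y) (axis i 1) $ j" for i j
    unfolding partial_deriv_def by (metis frechet_derivative_at)
  then show ?thesis
    by (simp add: curl_def cross3_def vec_eq_iff forall_3 sum_3 axis_def)
qed

lemma quad_approx_curl:
  assumes "C_diff 3 A"
  obtains L where "quad_approx (curl A) L y"
proof -
  have "curl A = (\<lambda>y. \<Sum>i\<in>UNIV. cross3 (axis i 1) (frechet_derivative A (at y) (axis i 1)))"
    using curl_eq_sum_cross3 C_diff_3(1)[OF assms] by blast
  moreover have "quad_approx (\<lambda>y. \<Sum>i\<in>UNIV. cross3 (axis i 1) (frechet_derivative A (at y) (axis i 1)))
      (\<lambda>d. \<Sum>i\<in>UNIV. cross3 (axis i 1)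
        (frechet_derivative (\<lambda>y. frechet_derivative A (at y) (axis i 1)) (at y) d)) y"
    by (intro quad_approx_sum C_diff_2_quad_approx C_diff_3(2)[OF assms] finite
        quad_approx_linear[OF bounded_bilinear.bounded_linear_right[OF bounded_bilinear_cross3]])
  ultimately show thesis using that by simp
qed

lemma grad_eq_sum:
  "grad U y = (\<Sum>i\<in>UNIV. frechet_derivative U (at y) (axis i 1) *\<^sub>R axis i 1)"
  by (simp add: grad_def partial_deriv_def vec_eq_iff forall_3 sum_3 axis_def)

lemma quad_approx_grad:
  assumes "C_diff 3 U"
  obtains L where "quad_approx (grad U) L y"
proof -
  have "grad U = (\<lambda>y. \<Sum>i\<in>UNIV. frechet_derivative U (at y) (axis i 1) *\<^sub>R axis i 1)"
    using grad_eq_sum by blast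
  moreover have "quad_approx (\<lambda>y. \<Sum>i\<in>UNIV. frechet_derivative U (at y) (axis i 1) *\<^sub>R axis i 1)
      (\<lambda>d. \<Sum>i\<in>UNIV.
        frechet_derivative (\<lambda>y. frechet_derivative U (at y) (axis i 1)) (at y) d *\<^sub>R axis i 1) y"
    by (intro quad_approx_sum C_diff_2_quad_approx C_diff_3(2)[OF assms] finite
        quad_approx_linear[OF bounded_linear_scaleR_left])
  ultimately show thesis using that by simp
qed

lemma continuous_grad:
  assumes "C_diff 3 U"
  shows "continuous_on UNIV (grad U)"
proof -
  have "(\<lambda>y. frechet_derivative U (at y) u) differentiable (at y)" for u y
  proof -
    have "C_diff (Suc 1) (\<lambda>y. frechet_derivative U (at y) u)"
      using C_diff_3(2)[OF assms, of u] by (simp only: numeral_2_eq_2 One_nat_def)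
    then show ?thesis by simp
  qed
  then have "continuous_on UNIV (\<lambda>y. frechet_derivative U (at y) u)" for u
    by (auto simp: continuous_on_eq_continuous_within intro: differentiable_imp_continuous_within)
  then show ?thesis
    unfolding grad_eq_sum[abs_def] by (intro continuous_intros)
qed

section \<open>Expansions of the solution and of the method\<close>

lemma jet_force:
  assumes k: "1 \<le> k" "k \<le> 2" and B: "quad_approx B L y"
    and Y: "jet H k Y y p" and W: "jet H k W w q" and f: "jet H k f f\<^sub>0 f\<^sub>1"
  shows "jet H k (\<lambda>h. Btilde B (Y h) *v W h + f h)
    (cross3 w (B y) + f\<^sub>0) (cross3 w (L p) + cross3 q (B y) + f\<^sub>1)"
  unfolding Btilde_mult
  by (rule jet_add[OF jet_bilinear[OF bounded_bilinear_cross3 W jet_compose[OF B Y k] k] f])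

text \<open>The acceleration is both a function of position and velocity and the derivative of the
  velocity. Expanding and integrating alternate, and each round raises the order by one.\<close>

lemma exact_expansion:
  assumes sol: "charged_particle_solution B F T x v" and t: "t \<in> T"
    and B: "quad_approx B LB (x t)" and F: "quad_approx F LF (x t)"
  defines "a\<^sub>0 \<equiv> cross3 (v t) (B (x t)) + F (x t)"
  defines "a\<^sub>1 \<equiv> cross3 (v t) (LB (v t)) + cross3 a\<^sub>0 (B (x t)) + LF (v t)"
  shows "remainder UNIV 3 (\<lambda>h. x (t + h) - x t - h *\<^sub>R v t - (h\<^sup>2 / 2) *\<^sub>R a\<^sub>0)"
    and "remainder UNIV 3 (\<lambda>h. v (t + h) - v t - h *\<^sub>R a\<^sub>0 - (h\<^sup>2 / 2) *\<^sub>R a\<^sub>1)"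
proof -
  let ?g = "\<lambda>s. Btilde B (x s) *v v s + F (x s)"
  have T: "open T" and x': "\<And>s. s \<in> T \<Longrightarrow> (x has_vector_derivative v s) (at s)"
    and v': "\<And>s. s \<in> T \<Longrightarrow> (v has_vector_derivative ?g s) (at s)"
    using sol unfolding charged_particle_solution_def by auto
  have g0: "?g t = a\<^sub>0" by (simp add: a\<^sub>0_def Btilde_mult)
  have force: "jet UNIV k (\<lambda>h. ?g (t + h)) (?g t) a\<^sub>1"
    if "1 \<le> k" "k \<le> 2" "jet UNIV k (\<lambda>h. x (t + h)) (x t) (v t)"
      "jet UNIV k (\<lambda>h. v (t + h)) (v t) a\<^sub>0" for k
    unfolding g0 using jet_force[OF that(1,2) B that(3,4) jet_compose[OF F that(3,1,2)]]
    by (simp only: a\<^sub>0_def a\<^sub>1_def)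
  have x1: "jet UNIV 1 (\<lambda>h. x (t + h)) (x t) (v t)"
    and v1: "jet UNIV 1 (\<lambda>h. v (t + h)) (v t) a\<^sub>0"
    using has_vector_derivative_jet x'[OF t] v'[OF t] by blast+
  have x2: "jet UNIV 2 (\<lambda>h. x (t + h)) (x t) (v t)"
    using jet_antiderivative[OF T t x' v1]
    by (intro remainder_quadratic_jet) (simp add: numeral_2_eq_2)
  have v2: "jet UNIV 2 (\<lambda>h. v (t + h)) (v t) a\<^sub>0"
    using jet_antiderivative[OF T t v' force[OF _ _ x1 v1]] unfolding g0
    by (intro remainder_quadratic_jet) (simp add: numeral_2_eq_2)
  show "remainder UNIV 3 (\<lambda>h. x (t + h) - x t - h *\<^sub>R v t - (h\<^sup>2 / 2) *\<^sub>R a\<^sub>0)"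
    using jet_antiderivative[OF T t x' v2] by (simp add: numeral_3_eq_3 numeral_2_eq_2)
  show "remainder UNIV 3 (\<lambda>h. v (t + h) - v t - h *\<^sub>R a\<^sub>0 - (h\<^sup>2 / 2) *\<^sub>R a\<^sub>1)"
    using jet_antiderivative[OF T t v' force[OF _ _ x2 v2]] unfolding g0
    by (simp add: numeral_3_eq_3 numeral_2_eq_2)
qed

text \<open>The averaged force \<open>g\<close> plays the role of the acceleration: \<open>V\<close> is \<open>v + h g\<close>, so
  the factor \<open>h\<close> replaces the integration. Its slope \<open>a\<^sub>1 / 2\<close> is where the symmetric averages
  matter; evaluating the fields at the old point only would give slope \<open>0\<close> from those terms and
  in general a method of order one.\<close>

lemma EP_expansion:
  assumes EP: "EP_result B F H x v X V"
    and B: "quad_approx B LB x" and F: "quad_approx F LF x" and cont: "continuous_on UNIV F"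
  defines "a\<^sub>0 \<equiv> cross3 v (B x) + F x"
  defines "a\<^sub>1 \<equiv> cross3 v (LB v) + cross3 a\<^sub>0 (B x) + LF v"
  shows "remainder H 3 (\<lambda>h. X h - x - h *\<^sub>R v - (h\<^sup>2 / 2) *\<^sub>R a\<^sub>0)"
    and "remainder H 3 (\<lambda>h. V h - v - h *\<^sub>R a\<^sub>0 - (h\<^sup>2 / 2) *\<^sub>R a\<^sub>1)"
proof -
  define g where "g h = Btilde B ((1 / 2) *\<^sub>R (X h + x)) *v ((1 / 2) *\<^sub>R (V h + v))
    + integral {0..1} (\<lambda>\<tau>. F (x + \<tau> *\<^sub>R (X h - x)))" for h
  have step: "\<forall>\<^sub>F h in at 0 within H. EP_step B F h x v (X h) (V h)"
    using EP by (simp add: EP_result_def)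
  have X: "\<forall>\<^sub>F h in at 0 within H. X h = x + h *\<^sub>R v + (h\<^sup>2 / 2) *\<^sub>R g h"
    using step
  proof eventually_elim
    case (elim h)
    then show ?case
      unfolding EP_step_def g_def scaleR_add_right[of "h\<^sup>2 / 2"] by (simp add: ac_simps)
  qed
  have V: "\<forall>\<^sub>F h in at 0 within H. V h = v + h *\<^sub>R g h"
    using step
  proof eventually_elim
    case (elim h)
    then show ?case
      unfolding EP_step_def g_def scaleR_add_right[of h] by (simp add: ac_simps)
  qed
  have mid: "jet H k (\<lambda>h. (1 / 2) *\<^sub>R (Y h + y)) y ((1 / 2) *\<^sub>R p)" if "jet H k Y y p"
    for k p y and Y :: "real \<Rightarrow> real^3"
  proof -
    have "(1 / 2) *\<^sub>R (y + y) = y"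
      by (simp flip: scaleR_2)
    then show ?thesis
      using jet_scaleR[OF jet_add[OF that jet_const[of H k y]], of "1 / 2"] by simp
  qed
  have force: "jet H k g a\<^sub>0 ((1 / 2) *\<^sub>R a\<^sub>1)"
    if k: "1 \<le> k" "k \<le> 2" and Xk: "jet H k X x v" and Vk: "jet H k V v a\<^sub>0" for k
  proof -
    \<comment> \<open>Each of the three terms of \<open>a\<^sub>1\<close> acquires its factor \<open>1/2\<close> from one of the averages.\<close>
    have "jet H k g a\<^sub>0 (cross3 v (LB ((1 / 2) *\<^sub>R v)) + cross3 ((1 / 2) *\<^sub>R a\<^sub>0) (B x) + (1 / 2) *\<^sub>R LF v)"
      unfolding g_def[abs_def] a\<^sub>0_def
      using jet_force[OF k B mid[OF Xk] mid[OF Vk]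
          jet_compose[OF quad_approx_segment_mean[OF cont F] Xk k]]
      by (simp add: a\<^sub>0_def)
    moreover have "LB ((1 / 2) *\<^sub>R v) = (1 / 2) *\<^sub>R LB v"
      using B by (simp add: quad_approx_def bounded_linear.linear linear_scale)
    ultimately show ?thesis
      by (simp add: a\<^sub>1_def cross_mult_left cross_mult_right scaleR_add_right)
  qed
  have X1: "jet H 1 X x v" and V1: "jet H 1 V v a\<^sub>0"
    using EP by (auto simp only: EP_result_def remainder_def power_one_right intro!: remainder_1_jet)
  have g1: "remainder H 1 (\<lambda>h. g h - a\<^sub>0)"
    using jet_remainder_1[OF force[OF _ _ X1 V1]] by simp
  \<comment> \<open>The force enters the position with \<open>h\<^sup>2\<close>, hence its first-round expansion already suffices there.\<close>
  have X3: "remainder H 3 (\<lambda>h. X h - x - h *\<^sub>R v - (h\<^sup>2 / 2) *\<^sub>R a\<^sub>0)"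
  proof (rule remainder_cong)
    show "\<forall>\<^sub>F h in at 0 within H. X h - x - h *\<^sub>R v - (h\<^sup>2 / 2) *\<^sub>R a\<^sub>0
        = (1 / 2) *\<^sub>R (h\<^sup>2 *\<^sub>R (g h - a\<^sub>0))"
      using X by eventually_elim (simp add: scaleR_diff_right)
    show "remainder H 3 (\<lambda>h. (1 / 2) *\<^sub>R (h\<^sup>2 *\<^sub>R (g h - a\<^sub>0)))"
      using remainder_linear[OF bounded_linear_scaleR_right remainder_scale[OF g1, of 2]]
      by (simp only: numeral_plus_one) (simp del: scaleR_scaleR)
  qed
  have X2: "jet H 2 X x v"
    by (rule remainder_quadratic_jet[OF remainder_lower[OF X3]]) simp
  have V2: "jet H 2 V v a\<^sub>0"
    unfolding jet_def
  proof (rule remainder_cong)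
    show "\<forall>\<^sub>F h in at 0 within H. V h - v - h *\<^sub>R a\<^sub>0 = h ^ 1 *\<^sub>R (g h - a\<^sub>0)"
      using V by eventually_elim (simp add: scaleR_diff_right)
    show "remainder H 2 (\<lambda>h. h ^ 1 *\<^sub>R (g h - a\<^sub>0))"
      using remainder_scale[OF g1, of 1] by (simp add: numeral_2_eq_2)
  qed
  have g2: "remainder H 2 (\<lambda>h. g h - a\<^sub>0 - h *\<^sub>R ((1 / 2) *\<^sub>R a\<^sub>1))"
    using force[OF _ _ X2 V2] by (simp add: jet_def)
  show "remainder H 3 (\<lambda>h. X h - x - h *\<^sub>R v - (h\<^sup>2 / 2) *\<^sub>R a\<^sub>0)"
    by (rule X3)
  show "remainder H 3 (\<lambda>h. V h - v - h *\<^sub>R a\<^sub>0 - (h\<^sup>2 / 2) *\<^sub>R a\<^sub>1)"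
  proof (rule remainder_cong)
    show "\<forall>\<^sub>F h in at 0 within H. V h - v - h *\<^sub>R a\<^sub>0 - (h\<^sup>2 / 2) *\<^sub>R a\<^sub>1
        = h ^ 1 *\<^sub>R (g h - a\<^sub>0 - h *\<^sub>R ((1 / 2) *\<^sub>R a\<^sub>1))"
      using V by eventually_elim (simp add: scaleR_diff_right power2_eq_square)
    show "remainder H 3 (\<lambda>h. h ^ 1 *\<^sub>R (g h - a\<^sub>0 - h *\<^sub>R ((1 / 2) *\<^sub>R a\<^sub>1)))"
      using remainder_scale[OF g2, of 1] by (simp add: numeral_3_eq_3)
  qed
qed

theorem theorem2p3:
  fixes A B F :: "real^3 \<Rightarrow> real^3" and U :: "real^3 \<Rightarrow> real"
    and T H :: "real set" and t\<^sub>n :: real and x\<^sub>n v\<^sub>n :: "real^3"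
    and x v X V :: "real \<Rightarrow> real^3"
  assumes "C_diff 3 A" and "C_diff 3 U"
    and "\<And>y. B y = curl A y" and "\<And>y. F y = - grad U y"
    and "charged_particle_solution B F T x v" and "t\<^sub>n \<in> T"
    and "x t\<^sub>n = x\<^sub>n" and "v t\<^sub>n = v\<^sub>n"
    and "EP_result B F H x\<^sub>n v\<^sub>n X V"
  shows "(\<lambda>h. norm (x (t\<^sub>n + h) - X h)) \<in> O[at 0 within H](\<lambda>h. h ^ 3) \<and>
         (\<lambda>h. norm (v (t\<^sub>n + h) - V h)) \<in> O[at 0 within H](\<lambda>h. h ^ 3)"
proof -
  have B_eq: "B = curl A" and F_eq: "F = (\<lambda>y. - grad U y)"
    using assms(3,4) by auto
  obtain LB where B: "quad_approx B LB x\<^sub>n"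
    unfolding B_eq by (rule quad_approx_curl[OF assms(1)])
  obtain LG where G: "quad_approx (grad U) LG x\<^sub>n"
    by (rule quad_approx_grad[OF assms(2)])
  have F: "quad_approx F (\<lambda>d. - LG d) x\<^sub>n"
    unfolding F_eq by (rule quad_approx_linear[OF bounded_linear_minus[OF bounded_linear_ident] G])
  have cont: "continuous_on UNIV F"
    unfolding F_eq by (intro continuous_on_minus continuous_grad assms(2))
  note exact = exact_expansion[OF assms(5,6), unfolded assms(7,8), OF B F, THEN remainder_within]
  note EP = EP_expansion[OF assms(9) B F cont]
  have "remainder H 3 (\<lambda>h. x (t\<^sub>n + h) - X h)" "remainder H 3 (\<lambda>h. v (t\<^sub>n + h) - V h)"
    using remainder_diff[OF exact(1) EP(1)] remainder_diff[OF exact(2) EP(2)]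
    by simp_all
  then show ?thesis by (simp add: remainder_def)
qed

end
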